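(* For every integer $n\ge 1$ there exists $Y_n>0$ such that for every real $y\ge Y_n$, the function $x\mapsto \operatorname{Re}\, v_n(x+iy)$ on $[0,1]$ is positive, concave, and attains its maximum at $x=1/2$.
   Context: For an integer $n\ge1$ and $z\in\mathbb{C}$, $$v_n(z)=\frac{\Gamma\left(z/2,\pi n^2\right)}{(\pi n^2)^{z/2}}+\frac{\Gamma\left((1-z)/2,\pi n^2\right)}{(\pi n^2)^{(1-z)/2}},$$ where, for $a>0$ and $w\in\mathbb{C}$, $\Gamma(w,a)=\int_a^\infty t^{w-1}e^{-t}\,dt$ is the upper incomplete gamma function and $a^w=e^{w\ln a}$ with real logarithm. *)

theory Defs
  imports "HOL-Analysis.Analysis"
begin

(* Meant for a > 0 only, where the integral converges absolutely for every complex w.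
   On positive reals, complex powr is exp (w * of_real (ln t)), i.e. it uses the real logarithm. *)
definition upper_incomplete_Gamma :: "complex \<Rightarrow> real \<Rightarrow> complex" where
  "upper_incomplete_Gamma w a =
     integral {a..} (\<lambda>t. complex_of_real t powr (w - 1) * complex_of_real (exp (- t)))"

definition v :: "nat \<Rightarrow> complex \<Rightarrow> complex" where
  "v n z =
     upper_incomplete_Gamma (z / 2) (pi * (real n)\<^sup>2)
       / complex_of_real (pi * (real n)\<^sup>2) powr (z / 2)
   + upper_incomplete_Gamma ((1 - z) / 2) (pi * (real n)\<^sup>2)
       / complex_of_real (pi * (real n)\<^sup>2) powr ((1 - z) / 2)"

end

theory Submission
  imports Defs
begin

text \<open>
  Put \<open>a = \<pi> n\<^sup>2\<close>. The substitution \<open>t = a e\<^bsup>2s\<^esup>\<close> turns the normalised incomplete gamma function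
  at \<open>z / 2\<close> into twice the integral of \<open>e\<^bsup>zs\<^esup> exp (- a e\<^bsup>2s\<^esup>)\<close> over \<open>s \<ge> 0\<close>. Hence the real part of
  \<open>v n (x + iy)\<close> equals \<open>2 c(x) + 2 c(1 - x)\<close>, where \<open>c(x)\<close> is the integral of
  \<open>F(x, s) cos (y s)\<close> with \<open>F(x, s) = exp (x s - a e\<^bsup>2s\<^esup>)\<close> (lemma \<open>Re_v\<close>). Evenness of the cosine
  is what allows the second summand to have the same frequency.

  Two integrations by parts show that, for smooth decaying \<open>f\<close>, the integral of \<open>f(s) cos (y s)\<close>
  is \<open>- (f'(0) + R) / y\<^sup>2\<close>, where \<open>R\<close> is the cosine integral of \<open>f''\<close> and therefore is \<open>O(1/y)\<close>.
  So its sign for large \<open>y\<close> is opposite to that of \<open>f'(0)\<close>. For \<open>f = F(x, \<cdot>)\<close> the derivative at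
  \<open>0\<close> is \<open>(x - 2 a) e\<^bsup>-a\<^esup>\<close>, which is negative for \<open>x \<in> [0, 1]\<close> because \<open>a > 1/2\<close>;
  so \<open>c(x) > 0\<close>. The second derivative \<open>c''(x)\<close> is the cosine integral of
  \<open>K(s) = s\<^sup>2 F(x, s)\<close>. Here \<open>K'(0) = 0\<close>, so the integral is \<open>- 1/y\<^sup>2\<close> times that of
  \<open>K''\<close>, and the derivative of \<open>K''\<close> at \<open>0\<close> is \<open>6\<close> times the \<open>s\<close>-derivative of \<open>F\<close> there,
  again negative; so \<open>c''(x) < 0\<close>. Thus \<open>c\<close> itself is positive and concave, and the symmetry under
  \<open>x \<mapsto> 1 - x\<close> puts the maximum of \<open>c(x) + c(1 - x)\<close> at \<open>1/2\<close>.

  The threshold for \<open>y\<close> must not depend on \<open>x\<close>. For this reason all estimates are made for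
  a class of functions of two variables (\<open>kernel\<close>) that is closed under \<open>s\<close>-derivatives and
  multiplication by \<open>s\<close> and whose members decay in \<open>s\<close> uniformly for bounded parameter
  (\<open>kernel_derivative\<close>, \<open>kernel_times_s\<close>, \<open>kernel_bound\<close>). The analytic core is
  \<open>cos_integral_by_parts\<close> with \<open>cos_integral_decay\<close>; the signs are read off in
  \<open>cos_integral_pos\<close> and \<open>cos_integral_s_squared_neg\<close>.
\<close>

section \<open>Kernels\<close>

text \<open>
  Differentiating the double exponential in \<open>s\<close> produces a factor \<open>e\<^bsup>2s\<^esup>\<close>, and differentiating
  \<open>e\<^bsup>\<beta>s\<^esup>\<close> a factor \<open>\<beta>\<close>. The exponents \<open>k\<close> and \<open>m\<close> make room for these factors, so that the
  span is closed under \<open>s\<close>-derivatives.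
\<close>

inductive kernel :: "real \<Rightarrow> (real \<Rightarrow> real \<Rightarrow> real) \<Rightarrow> bool" for a :: real where
  base: "kernel a (\<lambda>\<beta> s. \<beta> ^ m * s ^ i * exp ((\<beta> + real k) * s - a * exp (2 * s)))"
| add: "kernel a F \<Longrightarrow> kernel a G \<Longrightarrow> kernel a (\<lambda>\<beta> s. F \<beta> s + G \<beta> s)"
| scale: "kernel a F \<Longrightarrow> kernel a (\<lambda>\<beta> s. c * F \<beta> s)"

lemma kernel_times_s:
  assumes "kernel a F"
  shows "kernel a (\<lambda>\<beta> s. s * F \<beta> s)"
  using assms
proof induction
  case (base m i k)
  then show ?case
    using kernel.base[of a m "Suc i" k] by (simp add: mult_ac)
next
  case (add F G)
  then show ?case
    using kernel.add[OF add.IH] by (simp add: distrib_left)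
next
  case (scale F c)
  then show ?case
    using kernel.scale[OF scale.IH, of c] by (simp add: mult_ac)
qed

lemma kernel_times_s_squared:
  assumes "kernel a F"
  shows "kernel a (\<lambda>\<beta> s. s\<^sup>2 * F \<beta> s)"
  using kernel_times_s[OF kernel_times_s[OF assms]] by (simp add: power2_eq_square mult.assoc)

lemma kernel_derivative:
  assumes "kernel a F"
  obtains F' where "kernel a F'"
    and "\<And>\<beta> s. (F \<beta> has_real_derivative F' \<beta> s) (at s)"
proof -
  have "\<exists>F'. kernel a F' \<and> (\<forall>\<beta> s. (F \<beta> has_real_derivative F' \<beta> s) (at s))"
    using assms
  proof induction
    case (base m i k)
    define H where "H = (\<lambda>m i k \<beta> s. \<beta> ^ m * s ^ i * exp ((\<beta> + real k) * s - a * exp (2 * s)))"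
    have H: "kernel a (H m i k)" for m i k
      unfolding H_def by (rule kernel.base)
    have K: "kernel a (\<lambda>\<beta> s. real i * H m (i - 1) k \<beta> s + H (Suc m) i k \<beta> s
               + real k * H m i k \<beta> s + (- 2 * a) * H m i (k + 2) \<beta> s)"
      by (intro kernel.add kernel.scale H)
    have "(H m i k \<beta> has_real_derivative
            real i * H m (i - 1) k \<beta> s + H (Suc m) i k \<beta> s
               + real k * H m i k \<beta> s + (- 2 * a) * H m i (k + 2) \<beta> s) (at s)" for \<beta> s
    proof -
      have "exp ((\<beta> + real (k + 2)) * s - a * exp (2 * s))
          = exp (2 * s) * exp ((\<beta> + real k) * s - a * exp (2 * s))"
        by (simp flip: exp_add add: algebra_simps)
      then show ?thesis
        unfolding H_def
        by (auto intro!: derivative_eq_intros simp: algebra_simps)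
    qed
    with K show ?case unfolding H_def by blast
  next
    case (add F G)
    then obtain F' G' where
      "kernel a F'" "\<And>\<beta> s. (F \<beta> has_real_derivative F' \<beta> s) (at s)"
      "kernel a G'" "\<And>\<beta> s. (G \<beta> has_real_derivative G' \<beta> s) (at s)"
      by blast
    then show ?case
      by (intro exI[of _ "\<lambda>\<beta> s. F' \<beta> s + G' \<beta> s"]) (auto intro: kernel.add DERIV_add)
  next
    case (scale F c)
    then obtain F' where
      "kernel a F'" "\<And>\<beta> s. (F \<beta> has_real_derivative F' \<beta> s) (at s)"
      by blast
    then show ?case
      by (intro exI[of _ "\<lambda>\<beta> s. c * F' \<beta> s"]) (auto intro: kernel.scale DERIV_cmult)
  qed
  with that show thesis by blast
qed

text \<open>
  The double exponential beats everything: \<open>s \<le> e\<^sup>s\<close> gives both \<open>s\<^sup>i \<le> e\<^bsup>is\<^esup>\<close> and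
  \<open>e\<^bsup>2s\<^esup> \<ge> s\<^sup>2\<close>, after which the exponent is at most a quadratic in \<open>s\<close> with leading coefficient
  \<open>- a\<close> and can be bounded by completing the square. The constant depends on the parameter only
  through the bound \<open>R\<close>.
\<close>

lemma kernel_bound:
  assumes "kernel a F" and a: "a > 0"
  obtains C where "C \<ge> 0"
    and "\<And>\<beta> s. \<bar>\<beta>\<bar> \<le> R \<Longrightarrow> s \<ge> 0 \<Longrightarrow> \<bar>F \<beta> s\<bar> \<le> C * exp (- s)"
proof -
  have "\<exists>C\<ge>0. \<forall>\<beta> s. \<bar>\<beta>\<bar> \<le> R \<longrightarrow> s \<ge> 0 \<longrightarrow> \<bar>F \<beta> s\<bar> \<le> C * exp (- s)"
    using assms(1)
  proof induction
    case (base m i k)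
    define c where "c = R + real k + real i + 1"
    have "\<bar>\<beta> ^ m * s ^ i * exp ((\<beta> + real k) * s - a * exp (2 * s))\<bar>
        \<le> \<bar>R\<bar> ^ m * exp (c\<^sup>2 / (4 * a)) * exp (- s)"
      if \<beta>: "\<bar>\<beta>\<bar> \<le> R" and s: "s \<ge> 0" for \<beta> s
    proof -
      have "s ^ i \<le> exp s ^ i"
        using s exp_ge_add_one_self[of s] by (intro power_mono) linarith+
      then have si: "s ^ i \<le> exp (real i * s)"
        by (simp add: exp_of_nat_mult)
      have "s\<^sup>2 \<le> (exp s)\<^sup>2"
        using s exp_ge_add_one_self[of s] by (intro power_mono) linarith+
      then have "s\<^sup>2 \<le> exp (2 * s)"
        by (simp add: power2_eq_square flip: exp_add)
      then have "a * s\<^sup>2 \<le> a * exp (2 * s)"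
        using a by simp
      moreover have "c * s - a * s\<^sup>2 \<le> c\<^sup>2 / (4 * a)"
      proof -
        have "0 \<le> (2 * a * s - c)\<^sup>2" by simp
        then show ?thesis
          using a by (simp add: field_simps power2_eq_square)
      qed
      moreover have "\<beta> * s \<le> R * s"
        using \<beta> s by (intro mult_right_mono) auto
      ultimately have e: "real i * s + ((\<beta> + real k) * s - a * exp (2 * s)) \<le> c\<^sup>2 / (4 * a) - s"
        unfolding c_def by (simp add: algebra_simps)
      have "s ^ i * exp ((\<beta> + real k) * s - a * exp (2 * s))
          \<le> exp (real i * s) * exp ((\<beta> + real k) * s - a * exp (2 * s))"
        using si by (intro mult_right_mono) auto
      also have "\<dots> \<le> exp (c\<^sup>2 / (4 * a) - s)"
        using e by (simp flip: exp_add)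
      finally have B: "s ^ i * exp ((\<beta> + real k) * s - a * exp (2 * s))
          \<le> exp (c\<^sup>2 / (4 * a)) * exp (- s)"
        by (simp flip: exp_add)
      have "\<bar>\<beta>\<bar> ^ m \<le> \<bar>R\<bar> ^ m"
        using \<beta> by (intro power_mono) auto
      from mult_mono[OF this B] have "\<bar>\<beta>\<bar> ^ m * (s ^ i * exp ((\<beta> + real k) * s - a * exp (2 * s)))
          \<le> \<bar>R\<bar> ^ m * (exp (c\<^sup>2 / (4 * a)) * exp (- s))"
        using s by simp
      then show ?thesis
        using s by (simp add: abs_mult power_abs mult.assoc)
    qed
    then show ?case
      by (intro exI[of _ "\<bar>R\<bar> ^ m * exp (c\<^sup>2 / (4 * a))"]) auto
  next
    case (add F G)
    then obtain C D where CD: "C \<ge> 0" "D \<ge> 0"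
      "\<And>\<beta> s. \<bar>\<beta>\<bar> \<le> R \<Longrightarrow> s \<ge> 0 \<Longrightarrow> \<bar>F \<beta> s\<bar> \<le> C * exp (- s)"
      "\<And>\<beta> s. \<bar>\<beta>\<bar> \<le> R \<Longrightarrow> s \<ge> 0 \<Longrightarrow> \<bar>G \<beta> s\<bar> \<le> D * exp (- s)"
      by blast
    have "\<bar>F \<beta> s + G \<beta> s\<bar> \<le> (C + D) * exp (- s)" if "\<bar>\<beta>\<bar> \<le> R" "s \<ge> 0" for \<beta> s
      using CD(3)[OF that] CD(4)[OF that] by (simp add: distrib_right)
    with CD show ?case by (intro exI[of _ "C + D"]) auto
  next
    case (scale F c)
    then obtain C where C: "C \<ge> 0"
      "\<And>\<beta> s. \<bar>\<beta>\<bar> \<le> R \<Longrightarrow> s \<ge> 0 \<Longrightarrow> \<bar>F \<beta> s\<bar> \<le> C * exp (- s)"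
      by blast
    have "\<bar>c * F \<beta> s\<bar> \<le> (\<bar>c\<bar> * C) * exp (- s)" if "\<bar>\<beta>\<bar> \<le> R" "s \<ge> 0" for \<beta> s
      using mult_left_mono[OF C(2)[OF that], of "\<bar>c\<bar>"] by (simp add: abs_mult mult.assoc)
    with C show ?case by (intro exI[of _ "\<bar>c\<bar> * C"]) auto
  qed
  with that show thesis by blast
qed

section \<open>Cosine integrals over the half line\<close>

lemma integrable_dominated_by_exp:
  fixes f :: "real \<Rightarrow> 'a::euclidean_space"
  assumes "continuous_on {0..} f"
    and "\<And>s. s \<ge> 0 \<Longrightarrow> norm (f s) \<le> C * exp (- s)"
  shows "f absolutely_integrable_on {0..}"
proof (rule measurable_bounded_by_integrable_imp_absolutely_integrable)
  show "f \<in> borel_measurable (lebesgue_on {0..})"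
    using assms(1) by (intro continuous_imp_measurable_on_sets_lebesgue) auto
  show "(\<lambda>s. C * exp (- s)) integrable_on {0::real..}"
    using integrable_on_exp_minus_to_infinity[of 1 0] by (intro integrable_on_mult_right) simp
qed (use assms in auto)

lemma integral_dominated_by_exp:
  fixes f :: "real \<Rightarrow> real"
  assumes "f integrable_on {0..}"
    and "\<And>s. s \<ge> 0 \<Longrightarrow> \<bar>f s\<bar> \<le> C * exp (- s)"
  shows "\<bar>integral {0..} f\<bar> \<le> C"
proof -
  have e: "((\<lambda>s. C * exp (- s)) has_integral C) {0::real..}"
    using has_integral_mult_right[OF has_integral_exp_minus_to_infinity[of 1 0], of C] by simp
  have "norm (integral {0..} f) \<le> integral {0..} (\<lambda>s. C * exp (- s))"
    using assms e by (intro integral_norm_bound_integral) auto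
  then show ?thesis by (simp only: integral_unique[OF e] real_norm_def)
qed

text \<open>
  Adding \<open>C e\<^bsup>-s\<^esup>\<close> makes the integrand nonnegative, so that monotone convergence applies to the
  integrals over \<open>[0, y]\<close>; the added term is subtracted again at the end.
\<close>

lemma has_integral_to_infinity_FTC:
  fixes f F :: "real \<Rightarrow> real"
  assumes deriv: "\<And>s. (F has_real_derivative f s) (at s)"
    and bound: "\<And>s. s \<ge> 0 \<Longrightarrow> \<bar>f s\<bar> \<le> C * exp (- s)"
    and lim: "(F \<longlongrightarrow> 0) at_top"
  shows "(f has_integral (- F 0)) {0..}"
proof -
  define h where "h = (\<lambda>s. f s + C * exp (- s))"
  define G where "G = (\<lambda>s. F s - C * exp (- s))"
  have G: "(G has_real_derivative h s) (at s)" for s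
    unfolding G_def h_def by (auto intro!: derivative_eq_intros deriv)
  have I: "(h has_integral G y - G x) {x..y}" if "x \<le> y" for x y
    using that by (intro fundamental_theorem_of_calculus)
      (auto simp flip: has_real_derivative_iff_has_vector_derivative
        intro: DERIV_subset[OF G])
  have "(h has_integral (0 - G 0)) {0..}"
  proof (rule has_integral_to_inf)
    show "h integrable_on {0..y}" for y
      using I[of 0 y] by (cases "0 \<le> y") auto
    have "(G \<longlongrightarrow> 0 - C * 0) at_top"
      unfolding G_def
      by (intro tendsto_diff lim tendsto_mult tendsto_const
          filterlim_compose[OF exp_at_bot filterlim_uminus_at_bot_at_top])
    then have "((\<lambda>y. G y - G 0) \<longlongrightarrow> 0 - G 0) at_top"
      by (intro tendsto_diff tendsto_const) simp
    then show "((\<lambda>y. integral {0..y} h) \<longlongrightarrow> 0 - G 0) at_top"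
    proof (rule Lim_transform_eventually)
      show "\<forall>\<^sub>F y in at_top. G y - G 0 = integral {0..y} h"
        using eventually_ge_at_top[of 0]
        by eventually_elim (metis I integral_unique)
    qed
    show "h y \<ge> 0" if "y \<ge> 0" for y
      using bound[OF that] by (simp add: h_def)
  qed
  moreover have "((\<lambda>s. C * exp (- s)) has_integral C) {0::real..}"
    using has_integral_mult_right[OF has_integral_exp_minus_to_infinity[of 1 0], of C] by simp
  ultimately have "((\<lambda>s. h s - C * exp (- s)) has_integral (0 - G 0 - C)) {0..}"
    by (rule has_integral_diff)
  then show ?thesis by (simp add: h_def G_def)
qed

lemma tendsto_zero_dominated_by_exp:
  fixes f :: "real \<Rightarrow> real"
  assumes "\<And>s. s \<ge> 0 \<Longrightarrow> \<bar>f s\<bar> \<le> C * exp (- s)"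
  shows "(f \<longlongrightarrow> 0) at_top"
proof (rule Lim_null_comparison)
  show "\<forall>\<^sub>F s in at_top. norm (f s) \<le> C * exp (- s)"
    using eventually_ge_at_top[of 0] by eventually_elim (use assms in auto)
  have "((\<lambda>s::real. C * exp (- s)) \<longlongrightarrow> C * 0) at_top"
    by (intro tendsto_mult tendsto_const
        filterlim_compose[OF exp_at_bot filterlim_uminus_at_bot_at_top])
  then show "((\<lambda>s::real. C * exp (- s)) \<longlongrightarrow> 0) at_top" by simp
qed

definition cos_integral :: "(real \<Rightarrow> real) \<Rightarrow> real \<Rightarrow> real" where
  "cos_integral f y = integral {0..} (\<lambda>s. f s * cos (y * s))"

lemma kernel_continuous:
  assumes "kernel a F"
  shows "continuous_on A (F \<beta>)"
proof -
  obtain F' where "\<And>\<beta> s. (F \<beta> has_real_derivative F' \<beta> s) (at s)"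
    using kernel_derivative[OF assms] by blast
  then show ?thesis
    by (meson DERIV_isCont continuous_at_imp_continuous_on)
qed

lemma kernel_integrable:
  assumes F: "kernel a F" and a: "a > 0"
    and g: "continuous_on UNIV g" "\<And>s::real. \<bar>g s :: real\<bar> \<le> 1"
  shows "(\<lambda>s. F \<beta> s * g s) absolutely_integrable_on {0..}"
proof -
  obtain C where C: "C \<ge> 0"
    "\<And>x s. \<bar>x\<bar> \<le> \<bar>\<beta>\<bar> \<Longrightarrow> s \<ge> 0 \<Longrightarrow> \<bar>F x s\<bar> \<le> C * exp (- s)"
    using kernel_bound[OF F a, of "\<bar>\<beta>\<bar>"] by blast
  show ?thesis
  proof (rule integrable_dominated_by_exp)
    show "continuous_on {0..} (\<lambda>s. F \<beta> s * g s)"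
      by (intro continuous_intros kernel_continuous[OF F] continuous_on_subset[OF g(1)]) auto
    show "norm (F \<beta> s * g s) \<le> C * exp (- s)" if "s \<ge> 0" for s
      using mult_mono[OF C(2)[OF _ that] g(2)[of s]] C(1) by (simp add: abs_mult)
  qed
qed

lemma kernel_integrable_cos:
  assumes "kernel a F" "a > 0"
  shows "(\<lambda>s. F \<beta> s * cos (y * s)) integrable_on {0..}"
  by (intro set_lebesgue_integral_eq_integral(1) kernel_integrable[OF assms] continuous_intros
      abs_cos_le_one)

lemma kernel_integrable_sin:
  assumes "kernel a F" "a > 0"
  shows "(\<lambda>s. F \<beta> s * sin (y * s)) integrable_on {0..}"
  by (intro set_lebesgue_integral_eq_integral(1) kernel_integrable[OF assms] continuous_intros
      abs_sin_le_one)

text \<open>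
  One integration by parts: the boundary term contains \<open>sin 0 = 0\<close>, and the remaining sine integral
  carries the factor \<open>1/y\<close>.
\<close>

lemma cos_integral_decay:
  assumes F: "kernel a F" and a: "a > 0"
  obtains C where "C \<ge> 0"
    and "\<And>\<beta> y. \<beta> \<in> {0..1} \<Longrightarrow> y > 0 \<Longrightarrow> \<bar>cos_integral (F \<beta>) y\<bar> \<le> C / y"
proof -
  obtain F' where F': "kernel a F'" and d: "\<And>\<beta> s. (F \<beta> has_real_derivative F' \<beta> s) (at s)"
    using kernel_derivative[OF F] by blast
  obtain C where C: "C \<ge> 0" "\<And>\<beta> s. \<bar>\<beta>\<bar> \<le> 1 \<Longrightarrow> s \<ge> 0 \<Longrightarrow> \<bar>F \<beta> s\<bar> \<le> C * exp (- s)"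
    using kernel_bound[OF F a, of 1] by blast
  obtain D where D: "D \<ge> 0" "\<And>\<beta> s. \<bar>\<beta>\<bar> \<le> 1 \<Longrightarrow> s \<ge> 0 \<Longrightarrow> \<bar>F' \<beta> s\<bar> \<le> D * exp (- s)"
    using kernel_bound[OF F' a, of 1] by blast
  have "\<bar>cos_integral (F \<beta>) y\<bar> \<le> D / y" if "\<beta> \<in> {0..1}" and y: "y > 0" for \<beta> y
  proof -
    have \<beta>: "\<bar>\<beta>\<bar> \<le> 1" using that by auto
    define f where "f = (\<lambda>s. F \<beta> s * cos (y * s) + F' \<beta> s * sin (y * s) / y)"
    have "(f has_integral - (F \<beta> 0 * sin (y * 0) / y)) {0..}"
    proof (rule has_integral_to_infinity_FTC)
      show "((\<lambda>s. F \<beta> s * sin (y * s) / y) has_real_derivative f s) (at s)" for s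
        unfolding f_def using y
        by (auto intro!: derivative_eq_intros d simp: field_simps)
      show "\<bar>f s\<bar> \<le> (C + D / y) * exp (- s)" if s: "s \<ge> 0" for s
      proof -
        have "\<bar>F \<beta> s * cos (y * s)\<bar> \<le> C * exp (- s)"
          using mult_mono[OF C(2)[OF \<beta> s] abs_cos_le_one[of "y * s"]] C(1) by (simp add: abs_mult)
        moreover have "\<bar>F' \<beta> s * sin (y * s)\<bar> \<le> D * exp (- s)"
          using mult_mono[OF D(2)[OF \<beta> s] abs_sin_le_one[of "y * s"]] D(1) by (simp add: abs_mult)
        then have "\<bar>F' \<beta> s * sin (y * s) / y\<bar> \<le> D / y * exp (- s)"
          using y by (simp add: divide_right_mono)
        ultimately show ?thesis unfolding f_def distrib_right by linarith
      qed
      show "((\<lambda>s. F \<beta> s * sin (y * s) / y) \<longlongrightarrow> 0) at_top"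
      proof (rule tendsto_zero_dominated_by_exp)
        fix s :: real assume s: "s \<ge> 0"
        show "\<bar>F \<beta> s * sin (y * s) / y\<bar> \<le> C / y * exp (- s)"
          using mult_mono[OF C(2)[OF \<beta> s] abs_sin_le_one[of "y * s"]] C(1) y
          by (simp add: abs_mult divide_right_mono)
      qed
    qed
    then have "integral {0..} f = 0" by (simp add: integral_unique)
    then have "cos_integral (F \<beta>) y = - (integral {0..} (\<lambda>s. F' \<beta> s * sin (y * s)) / y)"
      unfolding f_def cos_integral_def
      using kernel_integrable_cos[OF F a, of \<beta> y] kernel_integrable_sin[OF F' a, of \<beta> y]
      by (subst (asm) integral_add) (auto intro: integrable_on_divide)
    moreover have "\<bar>integral {0..} (\<lambda>s. F' \<beta> s * sin (y * s))\<bar> \<le> D"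
    proof (rule integral_dominated_by_exp)
      show "(\<lambda>s. F' \<beta> s * sin (y * s)) integrable_on {0..}"
        by (rule kernel_integrable_sin[OF F' a])
      show "\<bar>F' \<beta> s * sin (y * s)\<bar> \<le> D * exp (- s)" if s: "s \<ge> 0" for s
        using mult_mono[OF D(2)[OF \<beta> s] abs_sin_le_one[of "y * s"]] D(1) by (simp add: abs_mult)
    qed
    ultimately show ?thesis using y by (simp add: divide_right_mono)
  qed
  with D(1) that show thesis by blast
qed

text \<open>
  Both integrations by parts are done at once, because
  \<open>F sin (y s) / y + F' cos (y s) / y\<^sup>2\<close> is an antiderivative of
  \<open>(F + F'' / y\<^sup>2) cos (y s)\<close>.
\<close>

lemma cos_integral_by_parts:
  assumes a: "a > 0" and y: "y > 0"
    and F: "kernel a F" and F': "kernel a F'" and F'': "kernel a F''"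
    and d: "\<And>\<beta> s. (F \<beta> has_real_derivative F' \<beta> s) (at s)"
    and d': "\<And>\<beta> s. (F' \<beta> has_real_derivative F'' \<beta> s) (at s)"
  shows "cos_integral (F \<beta>) y = - (F' \<beta> 0 + cos_integral (F'' \<beta>) y) / y\<^sup>2"
proof -
  obtain C where C: "C \<ge> 0" "\<And>x s. \<bar>x\<bar> \<le> \<bar>\<beta>\<bar> \<Longrightarrow> s \<ge> 0 \<Longrightarrow> \<bar>F x s\<bar> \<le> C * exp (- s)"
    using kernel_bound[OF F a, of "\<bar>\<beta>\<bar>"] by blast
  obtain D where D: "D \<ge> 0" "\<And>x s. \<bar>x\<bar> \<le> \<bar>\<beta>\<bar> \<Longrightarrow> s \<ge> 0 \<Longrightarrow> \<bar>F' x s\<bar> \<le> D * exp (- s)"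
    using kernel_bound[OF F' a, of "\<bar>\<beta>\<bar>"] by blast
  obtain E where E: "E \<ge> 0" "\<And>x s. \<bar>x\<bar> \<le> \<bar>\<beta>\<bar> \<Longrightarrow> s \<ge> 0 \<Longrightarrow> \<bar>F'' x s\<bar> \<le> E * exp (- s)"
    using kernel_bound[OF F'' a, of "\<bar>\<beta>\<bar>"] by blast
  define f where "f = (\<lambda>s. F \<beta> s * cos (y * s) + F'' \<beta> s * cos (y * s) / y\<^sup>2)"
  define P where "P = (\<lambda>s. F \<beta> s * sin (y * s) / y + F' \<beta> s * cos (y * s) / y\<^sup>2)"
  have "(f has_integral - P 0) {0..}"
  proof (rule has_integral_to_infinity_FTC)
    show "(P has_real_derivative f s) (at s)" for s
      unfolding f_def P_def using y
      by (auto intro!: derivative_eq_intros d d' simp: field_simps power2_eq_square)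
    show "\<bar>f s\<bar> \<le> (C + E / y\<^sup>2) * exp (- s)" if s: "s \<ge> 0" for s
    proof -
      have "\<bar>F \<beta> s * cos (y * s)\<bar> \<le> C * exp (- s)"
        using mult_mono[OF C(2)[OF order_refl s] abs_cos_le_one[of "y * s"]] C(1)
        by (simp add: abs_mult)
      moreover have "\<bar>F'' \<beta> s * cos (y * s)\<bar> \<le> E * exp (- s)"
        using mult_mono[OF E(2)[OF order_refl s] abs_cos_le_one[of "y * s"]] E(1)
        by (simp add: abs_mult)
      then have "\<bar>F'' \<beta> s * cos (y * s) / y\<^sup>2\<bar> \<le> E / y\<^sup>2 * exp (- s)"
        by (simp add: divide_right_mono)
      ultimately show ?thesis unfolding f_def distrib_right by linarith
    qed
    show "(P \<longlongrightarrow> 0) at_top"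
    proof (rule tendsto_zero_dominated_by_exp)
      fix s :: real assume s: "s \<ge> 0"
      have "\<bar>F \<beta> s * sin (y * s)\<bar> \<le> C * exp (- s)"
        using mult_mono[OF C(2)[OF order_refl s] abs_sin_le_one[of "y * s"]] C(1)
        by (simp add: abs_mult)
      then have "\<bar>F \<beta> s * sin (y * s) / y\<bar> \<le> C / y * exp (- s)"
        using y by (simp add: divide_right_mono)
      moreover have "\<bar>F' \<beta> s * cos (y * s)\<bar> \<le> D * exp (- s)"
        using mult_mono[OF D(2)[OF order_refl s] abs_cos_le_one[of "y * s"]] D(1)
        by (simp add: abs_mult)
      then have "\<bar>F' \<beta> s * cos (y * s) / y\<^sup>2\<bar> \<le> D / y\<^sup>2 * exp (- s)"
        by (simp add: divide_right_mono)
      ultimately show "\<bar>P s\<bar> \<le> (C / y + D / y\<^sup>2) * exp (- s)"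
        unfolding P_def distrib_right by linarith
    qed
  qed
  then have "integral {0..} f = - (F' \<beta> 0 / y\<^sup>2)" by (simp add: integral_unique P_def)
  moreover have "integral {0..} f = cos_integral (F \<beta>) y + cos_integral (F'' \<beta>) y / y\<^sup>2"
    unfolding f_def cos_integral_def
    using kernel_integrable_cos[OF F a, of \<beta> y] kernel_integrable_cos[OF F'' a, of \<beta> y]
    by (subst integral_add) (auto intro: integrable_on_divide)
  ultimately show ?thesis by (simp add: add_divide_distrib diff_divide_distrib)
qed

section \<open>Signs for large frequency\<close>

text \<open>
  In \<open>- (F'(0) + R) / y\<^sup>2\<close> the remainder \<open>R\<close> is at most \<open>C / y\<close>, which falls below the margin
  \<open>\<delta>\<close> as soon as \<open>y > C / \<delta>\<close>.
\<close>

lemma cos_integral_pos: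
  assumes a: "a > 0" and F: "kernel a F" and F': "kernel a F'"
    and d: "\<And>\<beta> s. (F \<beta> has_real_derivative F' \<beta> s) (at s)"
    and \<delta>: "\<delta> > 0" "\<And>\<beta>. \<beta> \<in> {0..1} \<Longrightarrow> F' \<beta> 0 \<le> - \<delta>"
  obtains Y where "Y > 0" "\<And>\<beta> y. \<beta> \<in> {0..1} \<Longrightarrow> y \<ge> Y \<Longrightarrow> cos_integral (F \<beta>) y > 0"
proof -
  obtain F'' where F'': "kernel a F''" and d': "\<And>\<beta> s. (F' \<beta> has_real_derivative F'' \<beta> s) (at s)"
    using kernel_derivative[OF F'] by blast
  obtain C where C: "C \<ge> 0"
    "\<And>\<beta> y. \<beta> \<in> {0..1} \<Longrightarrow> y > 0 \<Longrightarrow> \<bar>cos_integral (F'' \<beta>) y\<bar> \<le> C / y"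
    using cos_integral_decay[OF F'' a] by blast
  define Y where "Y = (C + 1) / \<delta>"
  have "Y > 0" using C \<delta> by (simp add: Y_def)
  moreover have "cos_integral (F \<beta>) y > 0" if \<beta>: "\<beta> \<in> {0..1}" and "y \<ge> Y" for \<beta> y
  proof -
    have y: "y > 0" using \<open>Y > 0\<close> that by linarith
    have "C < \<delta> * y"
      using that(2) \<delta>(1) by (simp add: Y_def field_simps)
    then have "C / y < \<delta>" using y by (simp add: field_simps)
    with C(2)[OF \<beta> y] \<delta>(2)[OF \<beta>] have "F' \<beta> 0 + cos_integral (F'' \<beta>) y < 0" by linarith
    then show ?thesis
      unfolding cos_integral_by_parts[OF a y F F' F'' d d', of \<beta>]
      using y by (simp add: divide_pos_pos)
  qed
  ultimately show thesis using that by blast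
qed

text \<open>
  With \<open>K = s\<^sup>2 F\<close> the boundary term \<open>K'(0)\<close> vanishes, so integrating by parts only multiplies by \<open>- 1 / y\<^sup>2\<close>
  and replaces \<open>K\<close> by \<open>K''\<close>. The previous lemma applies to \<open>K''\<close>, since \<open>K'''(0) = 6 F'(0)\<close>.
\<close>

lemma cos_integral_s_squared_neg:
  assumes a: "a > 0" and F: "kernel a F" and F': "kernel a F'"
    and d: "\<And>\<beta> s. (F \<beta> has_real_derivative F' \<beta> s) (at s)"
    and \<delta>: "\<delta> > 0" "\<And>\<beta>. \<beta> \<in> {0..1} \<Longrightarrow> F' \<beta> 0 \<le> - \<delta>"
  obtains Y where "Y > 0"
    "\<And>\<beta> y. \<beta> \<in> {0..1} \<Longrightarrow> y \<ge> Y \<Longrightarrow> cos_integral (\<lambda>s. s\<^sup>2 * F \<beta> s) y < 0"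
proof -
  obtain F'' where F'': "kernel a F''" and d': "\<And>\<beta> s. (F' \<beta> has_real_derivative F'' \<beta> s) (at s)"
    using kernel_derivative[OF F'] by blast
  obtain F3 where F3: "kernel a F3" and d'': "\<And>\<beta> s. (F'' \<beta> has_real_derivative F3 \<beta> s) (at s)"
    using kernel_derivative[OF F''] by blast
  define K where "K = (\<lambda>\<beta> s. s\<^sup>2 * F \<beta> s)"
  define K' where "K' = (\<lambda>\<beta> s. 2 * (s * F \<beta> s) + s\<^sup>2 * F' \<beta> s)"
  define K'' where "K'' = (\<lambda>\<beta> s. 2 * F \<beta> s + 4 * (s * F' \<beta> s) + s\<^sup>2 * F'' \<beta> s)"
  define K3 where "K3 = (\<lambda>\<beta> s. 6 * F' \<beta> s + 6 * (s * F'' \<beta> s) + s\<^sup>2 * F3 \<beta> s)"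
  note closure = kernel.add kernel.scale kernel_times_s kernel_times_s_squared F F' F'' F3
  have K: "kernel a K" "kernel a K'" "kernel a K''" "kernel a K3"
    unfolding K_def K'_def K''_def K3_def by (intro closure)+
  have dK: "(K \<beta> has_real_derivative K' \<beta> s) (at s)"
    and dK': "(K' \<beta> has_real_derivative K'' \<beta> s) (at s)"
    and dK'': "(K'' \<beta> has_real_derivative K3 \<beta> s) (at s)" for \<beta> s
    unfolding K_def K'_def K''_def K3_def
    by (auto intro!: derivative_eq_intros d d' d'' simp: algebra_simps power2_eq_square)
  have "6 * \<delta> > 0" "\<And>\<beta>. \<beta> \<in> {0..1} \<Longrightarrow> K3 \<beta> 0 \<le> - (6 * \<delta>)"
    using \<delta> by (auto simp: K3_def)
  then obtain Y where Y: "Y > 0"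
    "\<And>\<beta> y. \<beta> \<in> {0..1} \<Longrightarrow> y \<ge> Y \<Longrightarrow> cos_integral (K'' \<beta>) y > 0"
    using cos_integral_pos[OF a K(3,4) dK''] by metis
  have "cos_integral (K \<beta>) y < 0" if "\<beta> \<in> {0..1}" "y \<ge> Y" for \<beta> y
  proof -
    have y: "y > 0" using Y that by linarith
    have "K' \<beta> 0 = 0" by (simp add: K'_def)
    with Y(2)[OF that] y show ?thesis
      unfolding cos_integral_by_parts[OF a y K(1-3) dK dK', of \<beta>] by simp
  qed
  with Y(1) that show thesis unfolding K_def by blast
qed

section \<open>The transform of the double-exponential kernel\<close>

text \<open>
  The power \<open>s\<^sup>i\<close> makes this the \<open>i\<close>-th derivative in \<open>x\<close> of the function called \<open>c\<close> above; see
  \<open>cos_transform_has_derivative\<close>.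
\<close>

definition cos_transform :: "real \<Rightarrow> nat \<Rightarrow> real \<Rightarrow> real \<Rightarrow> real" where
  "cos_transform a i y x = cos_integral (\<lambda>s. s ^ i * exp (x * s - a * exp (2 * s))) y"

lemma kernel_double_exp: "kernel a (\<lambda>x s. s ^ i * exp (x * s - a * exp (2 * s)))"
  using kernel.base[of a 0 i 0] by simp

text \<open>
  Differentiation under the integral sign, by a quadratic estimate of the error: Taylor's bound
  \<open>\<bar>e\<^sup>u - 1 - u\<bar> \<le> u\<^sup>2 e\<^bsup>\<bar>u\<bar>\<^esup>\<close> with \<open>u = h s\<close> leaves \<open>h\<^sup>2\<close> times a kernel with two more powers of
  \<open>s\<close> and parameter \<open>x + \<bar>h\<bar>\<close>, whose integral is bounded for \<open>\<bar>h\<bar> \<le> 1\<close>.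
\<close>

lemma cos_transform_has_derivative:
  assumes a: "a > 0"
  shows "(cos_transform a i y has_real_derivative cos_transform a (Suc i) y x) (at x)"
proof -
  define H where "H = (\<lambda>j x s. s ^ j * exp (x * s - a * exp (2 * s)))"
  have H: "kernel a (H j)" for j
    unfolding H_def by (rule kernel_double_exp)
  have T: "cos_transform a j y x = integral {0..} (\<lambda>s. H j x s * cos (y * s))" for j x
    by (simp add: cos_transform_def cos_integral_def H_def)
  obtain M where M: "M \<ge> 0"
    "\<And>\<beta> s. \<bar>\<beta>\<bar> \<le> \<bar>x\<bar> + 1 \<Longrightarrow> s \<ge> 0 \<Longrightarrow> \<bar>H (i + 2) \<beta> s\<bar> \<le> M * exp (- s)"
    using kernel_bound[OF H[of "i + 2"] a, of "\<bar>x\<bar> + 1"] by blast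
  have est: "\<bar>cos_transform a i y (x + h) - cos_transform a i y x - h * cos_transform a (Suc i) y x\<bar>
      \<le> M * h\<^sup>2" if h: "\<bar>h\<bar> \<le> 1" for h
  proof -
    let ?f = "\<lambda>s. H i (x + h) s * cos (y * s) - H i x s * cos (y * s)
                - h * (H (Suc i) x s * cos (y * s))"
    have int: "(\<lambda>s. H j x s * cos (y * s)) integrable_on {0..}" for j x
      by (rule kernel_integrable_cos[OF H a])
    have f: "?f integrable_on {0..}"
      by (intro integrable_diff integrable_on_mult_right int)
    have "cos_transform a i y (x + h) - cos_transform a i y x - h * cos_transform a (Suc i) y x
        = integral {0..} ?f"
      unfolding T
      by (simp add: integral_diff int integrable_diff integrable_on_mult_right)
    moreover have "\<bar>integral {0..} ?f\<bar> \<le> M * h\<^sup>2"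
    proof (rule integral_dominated_by_exp[OF f])
      fix s :: real assume s: "s \<ge> 0"
      have "?f s = H i x s * (exp (h * s) - (1 + h * s)) * cos (y * s)"
        by (simp add: H_def algebra_simps flip: exp_add)
      also have "\<bar>\<dots>\<bar> \<le> \<bar>H i x s * (exp (h * s) - (1 + h * s))\<bar> * 1"
        unfolding abs_mult[of _ "cos (y * s)"] by (intro mult_left_mono) auto
      also have "\<dots> = H i x s * \<bar>exp (h * s) - (1 + h * s)\<bar>"
        using s by (simp add: H_def abs_mult)
      also have "\<dots> \<le> H i x s * (exp (\<bar>h\<bar> * s) * (h * s)\<^sup>2)"
      proof (rule mult_left_mono)
        show "\<bar>exp (h * s) - (1 + h * s)\<bar> \<le> exp (\<bar>h\<bar> * s) * (h * s)\<^sup>2"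
          using Taylor_exp_field[of "h * s" 1] s by (simp add: abs_mult power2_eq_square)
      qed (use s in \<open>simp add: H_def\<close>)
      also have "\<dots> = h\<^sup>2 * H (i + 2) (x + \<bar>h\<bar>) s"
        by (simp add: H_def power_mult_distrib power2_eq_square algebra_simps flip: exp_add)
      also have "\<dots> \<le> h\<^sup>2 * (M * exp (- s))"
      proof (rule mult_left_mono)
        have "\<bar>x + \<bar>h\<bar>\<bar> \<le> \<bar>x\<bar> + 1" using h by linarith
        from M(2)[OF this s] show "H (i + 2) (x + \<bar>h\<bar>) s \<le> M * exp (- s)" by linarith
      qed simp
      finally show "\<bar>?f s\<bar> \<le> M * h\<^sup>2 * exp (- s)" by (simp add: mult_ac)
    qed
    ultimately show ?thesis by simp
  qed
  show ?thesis
    unfolding DERIV_def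
  proof (rule LIM_zero_cancel, rule Lim_null_comparison)
    have "((\<lambda>h. M * \<bar>h\<bar>) \<longlongrightarrow> M * \<bar>0\<bar>) (at (0::real))"
      by (intro tendsto_intros)
    then show "((\<lambda>h. M * \<bar>h\<bar>) \<longlongrightarrow> 0) (at (0::real))" by simp
    have "\<forall>\<^sub>F h in at (0::real). h \<in> {-1<..<1} - {0}"
      by (rule eventually_at_in_open) auto
    then show "\<forall>\<^sub>F h in at 0. norm ((cos_transform a i y (x + h) - cos_transform a i y x) / h
        - cos_transform a (Suc i) y x) \<le> M * \<bar>h\<bar>"
    proof eventually_elim
      case (elim h)
      have "(cos_transform a i y (x + h) - cos_transform a i y x) / h - cos_transform a (Suc i) y x
          = (cos_transform a i y (x + h) - cos_transform a i y x
              - h * cos_transform a (Suc i) y x) / h"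
        using elim by (simp add: field_simps)
      then have "norm ((cos_transform a i y (x + h) - cos_transform a i y x) / h
          - cos_transform a (Suc i) y x) \<le> M * h\<^sup>2 / \<bar>h\<bar>"
        using divide_right_mono[OF est[of h], of "\<bar>h\<bar>"] elim by (simp add: abs_le_iff)
      also have "\<dots> = M * \<bar>h\<bar>"
        using elim by (simp add: power2_eq_square divide_simps)
      finally show ?case .
    qed
  qed
qed

text \<open>
  The bound on \<open>a\<close> is exactly what makes the \<open>s\<close>-derivative \<open>(x - 2 a) e\<^bsup>-a\<^esup>\<close> at \<open>0\<close> negative up to
  the endpoint \<open>x = 1\<close>.
\<close>

lemma cos_transform_signs:
  assumes a: "a > 1/2"
  obtains Y where "Y > 0"
    and "\<And>x y. x \<in> {0..1} \<Longrightarrow> y \<ge> Y \<Longrightarrow> cos_transform a 0 y x > 0"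
    and "\<And>x y. x \<in> {0..1} \<Longrightarrow> y \<ge> Y \<Longrightarrow> cos_transform a 2 y x < 0"
proof -
  have a0: "a > 0" using a by simp
  define F where "F = (\<lambda>x s. exp (x * s - a * exp (2 * s)))"
  define F' where "F' = (\<lambda>x s. x * F x s + (- 2 * a) * (exp (2 * s) * F x s))"
  have F: "kernel a F"
    using kernel_double_exp[of a 0] by (simp add: F_def)
  have "kernel a (\<lambda>x s. x * F x s)"
    using kernel.base[of a 1 0 0] by (simp add: F_def)
  moreover have "kernel a (\<lambda>x s. exp (2 * s) * F x s)"
    using kernel.base[of a 0 0 2] by (simp add: F_def algebra_simps flip: exp_add)
  ultimately have F': "kernel a F'"
    unfolding F'_def by (intro kernel.add kernel.scale)
  have d: "(F x has_real_derivative F' x s) (at s)" for x s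
    unfolding F_def F'_def by (auto intro!: derivative_eq_intros simp: algebra_simps)
  define \<delta> where "\<delta> = (2 * a - 1) * exp (- a)"
  have \<delta>: "\<delta> > 0" using a by (simp add: \<delta>_def)
  have \<delta>': "F' x 0 \<le> - \<delta>" if "x \<in> {0..1}" for x
  proof -
    have "F' x 0 = (x - 2 * a) * exp (- a)"
      by (simp add: F'_def F_def algebra_simps)
    also have "\<dots> \<le> (1 - 2 * a) * exp (- a)"
      using that by (intro mult_right_mono) auto
    finally show ?thesis by (simp add: \<delta>_def algebra_simps)
  qed
  obtain Y1 where Y1: "Y1 > 0" "\<And>x y. x \<in> {0..1} \<Longrightarrow> y \<ge> Y1 \<Longrightarrow> cos_integral (F x) y > 0"
    using cos_integral_pos[OF a0 F F' d \<delta> \<delta>'] by metis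
  obtain Y2 where Y2: "Y2 > 0"
    "\<And>x y. x \<in> {0..1} \<Longrightarrow> y \<ge> Y2 \<Longrightarrow> cos_integral (\<lambda>s. s\<^sup>2 * F x s) y < 0"
    using cos_integral_s_squared_neg[OF a0 F F' d \<delta> \<delta>'] by metis
  show thesis
    using Y1 Y2 by (intro that[of "max Y1 Y2"]) (auto simp: cos_transform_def F_def)
qed

section \<open>The incomplete gamma function\<close>

text \<open>
  The substitution \<open>t = p(s) = a e\<^bsup>2s\<^esup>\<close> has \<open>p' = 2 p\<close>, which raises the exponent \<open>z / 2 - 1\<close> to
  \<open>z / 2\<close>; then \<open>p(s)\<close> to the power \<open>z / 2\<close> is \<open>e\<^bsup>zs\<^esup>\<close> times the factor that the quotient removes.
\<close>

lemma Re_upper_incomplete_Gamma_quotient: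
  assumes a: "a > 0"
  shows "Re (upper_incomplete_Gamma (z / 2) a / complex_of_real a powr (z / 2))
       = 2 * cos_transform a 0 (Im z) (Re z)"
proof -
  define f where "f = (\<lambda>t. complex_of_real t powr (z / 2 - 1) * complex_of_real (exp (- t)))"
  define p where "p = (\<lambda>s. a * exp (2 * s))"
  define q where "q = (\<lambda>s. exp (z * complex_of_real s) * complex_of_real (exp (- a * exp (2 * s))))"
  define A where "A = complex_of_real a powr (z / 2)"
  have A: "A \<noteq> 0" using a by (simp add: A_def)
  have norm_q: "norm (q s) = exp (Re z * s - a * exp (2 * s))" for s
    by (simp add: q_def norm_mult flip: exp_add)
  have Re_q: "Re (q s) = s ^ 0 * exp (Re z * s - a * exp (2 * s)) * cos (Im z * s)" for s
    by (simp add: q_def Re_exp exp_diff exp_minus field_simps power2_eq_square)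
  obtain M where M: "\<And>x s. \<bar>x\<bar> \<le> \<bar>Re z\<bar> \<Longrightarrow> s \<ge> 0 \<Longrightarrow>
      \<bar>s ^ 0 * exp (x * s - a * exp (2 * s))\<bar> \<le> M * exp (- s)"
    using kernel_bound[OF kernel_double_exp a, of "\<bar>Re z\<bar>" 0] by metis
  have q: "q absolutely_integrable_on {0..}"
  proof (rule integrable_dominated_by_exp)
    show "continuous_on {0..} q"
      unfolding q_def by (intro continuous_intros)
    show "norm (q s) \<le> M * exp (- s)" if "s \<ge> 0" for s
      using M[OF order_refl that] by (simp add: norm_q)
  qed
  have image: "p ` {0..} = {a..}"
  proof (intro equalityI subsetI)
    fix t assume "t \<in> {a..}"
    then have "t = p (ln (t / a) / 2)" "ln (t / a) / 2 \<ge> 0"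
      using a by (auto simp: p_def)
    then show "t \<in> p ` {0..}" by blast
  qed (use a in \<open>auto simp: p_def\<close>)
  have integrand: "\<bar>2 * p s\<bar> *\<^sub>R f (p s) = 2 * A * q s" for s
  proof -
    have ps: "p s > 0" using a by (simp add: p_def)
    have "complex_of_real (p s) * complex_of_real (p s) powr (z / 2 - 1)
        = complex_of_real (p s) powr (z / 2)"
      using ps by (simp add: powr_diff)
    also have "\<dots> = exp (z / 2 * complex_of_real (ln (p s)))"
      using ps by (simp add: powr_def Ln_of_real)
    also have "ln (p s) = ln a + 2 * s"
      using a by (simp add: p_def ln_mult)
    also have "exp (z / 2 * complex_of_real (ln a + 2 * s)) = A * exp (z * complex_of_real s)"
      using a by (simp add: A_def powr_def Ln_of_real algebra_simps flip: exp_add)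
    finally show ?thesis
      using ps by (simp add: f_def q_def scaleR_conv_of_real mult_ac) (simp add: p_def)
  qed
  have deriv: "(p has_field_derivative 2 * p s) (at s within {0..})" for s
    unfolding p_def by (auto intro!: derivative_eq_intros)
  have inj: "inj_on p {0..}"
    using a by (auto simp: p_def inj_on_def)
  have "(\<lambda>s. 2 * A * q s) absolutely_integrable_on {0..}"
    using q by (intro set_integrable_mult_right)
  then have "integral (p ` {0..}) f = integral {0..} (\<lambda>s. 2 * A * q s)"
    using has_absolute_integral_change_of_variables_real
      [OF _ deriv inj, of f "integral {0..} (\<lambda>s. 2 * A * q s)"]
    by (simp add: integrand)
  then have "upper_incomplete_Gamma (z / 2) a = 2 * A * integral {0..} q"
    by (simp add: image upper_incomplete_Gamma_def f_def)
  then have "upper_incomplete_Gamma (z / 2) a / A = 2 * integral {0..} q"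
    using A by simp
  moreover have "Re (integral {0..} q) = cos_transform a 0 (Im z) (Re z)"
  proof -
    have "(q has_integral integral {0..} q) {0..}"
      using q set_lebesgue_integral_eq_integral(1) by blast
    from has_integral_Re[OF this] show ?thesis
      unfolding cos_transform_def cos_integral_def Re_q by (simp add: integral_unique)
  qed
  ultimately show ?thesis by (simp add: A_def)
qed

lemma Re_v:
  assumes "n \<ge> 1"
  shows "Re (v n (Complex x y)) = 2 * cos_transform (pi * (real n)\<^sup>2) 0 y x
                                + 2 * cos_transform (pi * (real n)\<^sup>2) 0 y (1 - x)"
proof -
  have a: "pi * (real n)\<^sup>2 > 0" using assms by simp
  have even: "cos_transform a i (- y) x = cos_transform a i y x" for a i x
    by (simp add: cos_transform_def cos_integral_def)
  show ?thesis
    unfolding v_def plus_complex.sel Re_upper_incomplete_Gamma_quotient[OF a]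
    by (simp add: even)
qed

theorem mainTheorem3:
  fixes n :: nat
  assumes "n \<ge> 1"
  shows "\<exists>Y::real. Y > 0 \<and>
    (\<forall>y::real. y \<ge> Y \<longrightarrow>
      (\<forall>x\<in>{0..1}. Re (v n (Complex x y)) > 0) \<and>
      concave_on {0..1} (\<lambda>x. Re (v n (Complex x y))) \<and>
      is_arg_max (\<lambda>x. Re (v n (Complex x y))) (\<lambda>x. x \<in> {0..1}) (1/2))"
proof -
  define a where "a = pi * (real n)\<^sup>2"
  have "1 * 1 \<le> pi * (real n)\<^sup>2"
    using assms pi_gt3 by (intro mult_mono) auto
  then have a: "a > 1/2" "a > 0" by (auto simp: a_def)
  obtain Y where Y: "Y > 0"
    and pos: "\<And>x y. x \<in> {0..1} \<Longrightarrow> y \<ge> Y \<Longrightarrow> cos_transform a 0 y x > 0"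
    and neg: "\<And>x y. x \<in> {0..1} \<Longrightarrow> y \<ge> Y \<Longrightarrow> cos_transform a 2 y x < 0"
    using cos_transform_signs[OF a(1)] by blast
  show ?thesis
  proof (intro exI[of _ Y] conjI allI impI)
    fix y assume y: "y \<ge> Y"
    define f where "f = (\<lambda>x. Re (v n (Complex x y)))"
    have f: "f x = 2 * cos_transform a 0 y x + 2 * cos_transform a 0 y (1 - x)" for x
      unfolding f_def a_def by (rule Re_v[OF assms])
    have f_symm: "f (1 - x) = f x" for x by (simp add: f)
    show "\<forall>x\<in>{0..1}. Re (v n (Complex x y)) > 0"
    proof
      fix x :: real assume "x \<in> {0..1}"
      then have "f x > 0" using pos[of x y] pos[of "1 - x" y] y by (simp add: f)
      then show "Re (v n (Complex x y)) > 0" by (simp add: f_def)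
    qed
    have concave: "concave_on {0..1} f"
    proof (rule f''_le0_imp_concave)
      note D = cos_transform_has_derivative[OF a(2)]
      have D': "((\<lambda>x. cos_transform a i y (1 - x)) has_real_derivative
          - cos_transform a (Suc i) y (1 - x)) (at x)" for i x
      proof -
        have "((\<lambda>x. 1 - x) has_real_derivative -1) (at x)"
          by (auto intro!: derivative_eq_intros)
        from DERIV_chain2[OF D this] show ?thesis by simp
      qed
      show "(f has_real_derivative 2 * cos_transform a 1 y x - 2 * cos_transform a 1 y (1 - x)) (at x)"
        for x
        unfolding f by (auto intro!: derivative_eq_intros D D')
      show "((\<lambda>x. 2 * cos_transform a 1 y x - 2 * cos_transform a 1 y (1 - x)) has_real_derivative
          2 * cos_transform a 2 y x + 2 * cos_transform a 2 y (1 - x)) (at x)" for x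
        using D[of 1 y x] D'[of 1 x] by (auto intro!: derivative_eq_intros simp: numeral_2_eq_2)
      show "2 * cos_transform a 2 y x + 2 * cos_transform a 2 y (1 - x) \<le> 0" if "x \<in> {0..1}" for x
        using neg[of x y] neg[of "1 - x" y] y that by auto
    qed simp
    then show "concave_on {0..1} (\<lambda>x. Re (v n (Complex x y)))" by (simp add: f_def)
    have "f x \<le> f (1/2)" if "x \<in> {0..1}" for x
    proof -
      have "(1 - 1/2) * f x + 1/2 * f (1 - x) \<le> f ((1 - 1/2) *\<^sub>R x + (1/2) *\<^sub>R (1 - x))"
        using that by (intro concave_onD[OF concave]) auto
      then show ?thesis by (simp add: f_symm field_simps)
    qed
    then show "is_arg_max (\<lambda>x. Re (v n (Complex x y))) (\<lambda>x. x \<in> {0..1}) (1/2)"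
      by (auto simp: is_arg_max_def f_def not_less)
  qed (rule Y)
qed

end
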